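(* Let $f:\mathbb{R}^n\to\mathbb{R}$ be differentiable and strongly convex with matrix $H\in\mathbb{S}_{++}^n$, let $h:\mathbb{R}^n\to\mathbb{R}\cup\{\infty\}$ be proper, closed and convex, let $A\in\mathbb{R}^{m\times n}$ have full row rank, let $B\in\mathbb{R}^{p\times n}$ and $b\in\mathbb{R}^m$. Put $C=[A^T~B^T]^T\in\mathbb{R}^{(m+p)\times n}$, $c=(b,0)\in\mathbb{R}^{m+p}$, $F=f+h$, and define $d:\mathbb{R}^{m+p}\to\mathbb{R}$ by $$d(\nu)=-F^\star(-C^T\nu)-c^T\nu .$$ Then $d$ is concave and differentiable, and $$d(\nu_1)\ge d(\nu_2)+\langle\nabla d(\nu_2),\nu_1-\nu_2\rangle-\tfrac12\|\nu_1-\nu_2\|_{\mathbf{L}}^2$$ holds for every $\nu_1,\nu_2\in\mathbb{R}^{m+p}$ and every $\mathbf{L}\in\mathbb{S}_+^{m+p}$ that satisfies $\mathbf{L}\succeq CH^{-1}C^T$.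
   Context: $\mathbb{S}_+^k$ and $\mathbb{S}_{++}^k$ are the sets of symmetric positive semidefinite, respectively positive definite, real $k\times k$ matrices; $L\succeq M$ means $L-M$ is symmetric positive semidefinite; $\|x\|_M^2=x^TMx$. The conjugate of $F$ is $F^\star(y)=\sup_x\{y^Tx-F(x)\}$. A differentiable $f:\mathbb{R}^n\to\mathbb{R}$ is strongly convex with matrix $H\in\mathbb{S}_{++}^n$ if $f(x_1)\ge f(x_2)+\langle\nabla f(x_2),x_1-x_2\rangle+\frac12\|x_1-x_2\|_H^2$ for all $x_1,x_2\in\mathbb{R}^n$. *)

theory Defs
  imports "HOL-Analysis.Analysis"
begin

definition pos_semidef :: "real^'k^'k \<Rightarrow> bool" where
  "pos_semidef M \<longleftrightarrow> transpose M = M \<and> (\<forall>x. 0 \<le> x \<bullet> (M *v x))"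

definition pos_def :: "real^'k^'k \<Rightarrow> bool" where
  "pos_def M \<longleftrightarrow> transpose M = M \<and> (\<forall>x. x \<noteq> 0 \<longrightarrow> 0 < x \<bullet> (M *v x))"

definition loewner_ge :: "real^'k^'k \<Rightarrow> real^'k^'k \<Rightarrow> bool" where
  "loewner_ge L M \<longleftrightarrow> pos_semidef (L - M)"

definition mat_norm_sq :: "real^'k^'k \<Rightarrow> real^'k \<Rightarrow> real" where
  "mat_norm_sq M x = x \<bullet> (M *v x)"

text \<open>The value is only meaningful where the function is differentiable.\<close>

definition gradient :: "('a::real_inner \<Rightarrow> real) \<Rightarrow> 'a \<Rightarrow> 'a" where
  "gradient f x = (THE g. GDERIV f x :> g)"

lemma gradient_eqI: "gradient f x = g" if "GDERIV f x :> g"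
  unfolding gradient_def
proof (rule the_equality[where P = "\<lambda>g. GDERIV f x :> g", OF that])
  fix g' assume "GDERIV f x :> g'"
  with that have "(\<lambda>h. h \<bullet> g') = (\<lambda>h. h \<bullet> g)"
    unfolding gderiv_def by (rule has_derivative_unique[rotated])
  then have "(g' - g) \<bullet> g' = (g' - g) \<bullet> g" by (rule fun_cong)
  then have "(g' - g) \<bullet> (g' - g) = 0" by (simp add: inner_diff_right)
  then show "g' = g" by simp
qed

lemma GDERIV_gradient:
  fixes f :: "'a::euclidean_space \<Rightarrow> real"
  assumes "f differentiable (at x)"
  shows "GDERIV f x :> gradient f x"
proof -
  from assms obtain f' where f': "(f has_derivative f') (at x)"
    by (auto simp: differentiable_def)
  then have "linear f'" by (rule has_derivative_linear)
  then have "f' = (\<lambda>h. h \<bullet> adjoint f' 1)"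
    by (simp add: adjoint_works fun_eq_iff)
  with f' have "GDERIV f x :> adjoint f' 1" by (simp add: gderiv_def)
  then show ?thesis using gradient_eqI by metis
qed

definition strongly_convex_with :: "real^'n^'n \<Rightarrow> (real^'n \<Rightarrow> real) \<Rightarrow> bool" where
  "strongly_convex_with H f \<longleftrightarrow>
     (\<forall>x1 x2. f x1 \<ge> f x2 + gradient f x2 \<bullet> (x1 - x2) + 1/2 * mat_norm_sq H (x1 - x2))"

text \<open>Epigraph of an extended-real-valued function, as a subset of
  \<^typ>\<open>'a \<times> real\<close>; points where the value is \<^term>\<open>\<infinity>::ereal\<close> contribute nothing.
  The library constant \<^const>\<open>epigraph\<close> only covers real-valued functions.\<close>

definition ext_epigraph :: "('a \<Rightarrow> ereal) \<Rightarrow> ('a \<times> real) set" where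
  "ext_epigraph h = {(x, r). h x \<le> ereal r}"

definition proper_fun :: "('a \<Rightarrow> ereal) \<Rightarrow> bool" where
  "proper_fun h \<longleftrightarrow> (\<forall>x. h x \<noteq> -\<infinity>) \<and> (\<exists>x. h x \<noteq> \<infinity>)"

definition closed_fun :: "('a::topological_space \<Rightarrow> ereal) \<Rightarrow> bool" where
  "closed_fun h \<longleftrightarrow> closed (ext_epigraph h)"

definition convex_fun :: "('a::real_vector \<Rightarrow> ereal) \<Rightarrow> bool" where
  "convex_fun h \<longleftrightarrow> convex (ext_epigraph h)"

definition conjugate :: "('a::real_inner \<Rightarrow> ereal) \<Rightarrow> 'a \<Rightarrow> ereal" where
  "conjugate F y = (SUP x. ereal (y \<bullet> x) - F x)"

text \<open>Block matrices and block vectors with \<open>m + p\<close> rows are indexed by the sum type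
  \<^typ>\<open>'m + 'p\<close>.\<close>

definition stack_rows :: "real^'n^'m \<Rightarrow> real^'n^'p \<Rightarrow> real^'n^('m + 'p)" where
  "stack_rows A B = (\<chi> i. case i of Inl j \<Rightarrow> A $ j | Inr k \<Rightarrow> B $ k)"

definition stack_vec :: "real^'m \<Rightarrow> real^'p \<Rightarrow> real^('m + 'p)" where
  "stack_vec u v = (\<chi> i. case i of Inl j \<Rightarrow> u $ j | Inr k \<Rightarrow> v $ k)"

text \<open>The dual function is extended-real-valued, so that its finiteness is a claim
  and not a convention.\<close>

definition dual_fun ::
  "(real^'n \<Rightarrow> ereal) \<Rightarrow> real^'n^'k \<Rightarrow> real^'k \<Rightarrow> real^'k \<Rightarrow> ereal" where
  "dual_fun F C c \<nu> = - conjugate F (- (transpose C *v \<nu>)) - ereal (c \<bullet> \<nu>)"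

end

theory Submission
  imports Defs
begin

text \<open>
  The proof shows that the conjugate of \<open>F\<close> is smooth by trapping it between two quadratic models.
  Fix \<open>y\<close>. Since \<open>f\<close> grows quadratically and \<open>h\<close> is closed and has an affine minorant, the tilted
  function \<open>z \<mapsto> F z - y \<bullet> z\<close> attains its minimum at some point \<open>x\<close>
  (lemma \<open>tilted_minimizer_exists\<close>). By strong convexity it exceeds this minimum at \<open>z\<close> by at
  least half the squared \<open>H\<close>-distance between \<open>z\<close> and \<open>x\<close>
  (lemma \<open>tilted_minimizer_quadratic_growth\<close>). Hence, for every \<open>y'\<close>, the gap between the
  conjugate at \<open>y'\<close> and the affine function \<open>y' \<mapsto> y' \<bullet> x - F x\<close> that touches it at \<open>y\<close>
  is nonnegative and at most the conjugate of \<open>u \<mapsto> 1/2 * mat_norm_sq H u\<close> at \<open>y' - y\<close>, which is the halved form of the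
  inverse matrix (lemma \<open>conjugate_quadratic_bounds\<close>).

  Substituting \<open>y = - C\<^sup>T \<nu>\<close> gives for \<open>d\<close> the supergradient \<open>C *v x - c\<close> at \<open>\<nu>\<close>, with an error
  between zero and half the form of \<open>C H\<^sup>-\<^sup>1 C\<^sup>T\<close>. These two bounds yield everything at once:
  supergradients everywhere give concavity, a quadratic error gives differentiability with that
  supergradient as gradient, and the lower bound is the asserted inequality for the least
  admissible \<open>L\<close>, from which that for larger \<open>L\<close> follows.
\<close>

section \<open>Quadratic forms of positive definite matrices\<close>

text \<open>The constant is the minimum of the form on the unit sphere, which is compact; homogeneity of
  degree two does the rest.\<close>

lemma pos_def_coercive:
  fixes H :: "real^'n^'n"
  assumes "pos_def H"
  obtains \<mu> where "\<mu> > 0" "\<And>x. \<mu> * (norm x)\<^sup>2 \<le> mat_norm_sq H x"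
proof -
  have cont: "continuous_on (sphere 0 1) (mat_norm_sq H)"
    unfolding mat_norm_sq_def by (intro continuous_intros)
  have "sphere (0::real^'n) 1 \<noteq> {}"
    by simp
  from continuous_attains_inf[OF compact_sphere this cont] obtain u
    where u: "u \<in> sphere 0 1" "\<And>x. x \<in> sphere 0 1 \<Longrightarrow> mat_norm_sq H u \<le> mat_norm_sq H x"
    by blast
  have "mat_norm_sq H u * (norm x)\<^sup>2 \<le> mat_norm_sq H x" for x
  proof (cases "x = 0")
    case False
    have "mat_norm_sq H u \<le> mat_norm_sq H (x /\<^sub>R norm x)"
      using False by (intro u) simp
    also have "\<dots> = mat_norm_sq H x / (norm x)\<^sup>2"
      by (simp add: mat_norm_sq_def matrix_vector_mult_scaleR power2_eq_square divide_simps)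
    finally show ?thesis
      using False by (simp add: pos_le_divide_eq)
  qed (simp add: mat_norm_sq_def)
  moreover have "mat_norm_sq H u > 0"
    using assms u(1) unfolding pos_def_def mat_norm_sq_def by (cases "u = 0") auto
  ultimately show ?thesis
    using that by blast
qed

lemma mat_norm_sq_le_norm_sq:
  fixes M :: "real^'n^'n"
  obtains K where "\<And>x. mat_norm_sq M x \<le> K * (norm x)\<^sup>2"
proof
  fix x :: "real^'n"
  have "mat_norm_sq M x \<le> norm x * norm (M *v x)"
    unfolding mat_norm_sq_def by (rule norm_cauchy_schwarz)
  also have "\<dots> \<le> norm x * (onorm ((*v) M) * norm x)"
    by (intro mult_left_mono onorm matrix_vector_mul_bounded_linear norm_ge_zero)
  finally show "mat_norm_sq M x \<le> onorm ((*v) M) * (norm x)\<^sup>2"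
    by (simp add: power2_eq_square mult_ac)
qed

lemma pos_def_matrix_inv:
  fixes H :: "real^'n^'n"
  assumes "pos_def H"
  shows "H *v (matrix_inv H *v w) = w"
proof -
  have "\<forall>x. H *v x = 0 \<longrightarrow> x = 0"
    using assms unfolding pos_def_def by (metis inner_zero_right less_irrefl)
  then have "invertible H"
    by (simp add: invertible_left_inverse matrix_left_invertible_ker)
  then have "H ** matrix_inv H = mat 1"
    unfolding invertible_def matrix_inv_def by (rule someI_ex[THEN conjunct1])
  then show ?thesis
    by (simp add: matrix_vector_mul_assoc)
qed

lemma symmetric_matrix_inner:
  fixes H :: "real^'n^'n"
  assumes "transpose H = H"
  shows "x \<bullet> (H *v y) = y \<bullet> (H *v x)"
  by (metis assms dot_lmul_matrix inner_commute transpose_matrix_vector)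

text \<open>The halved forms of \<open>H\<close> and of its inverse are conjugate to each other; this is the
  Fenchel--Young inequality for that pair, obtained by completing the square around the maximiser
  \<open>matrix_inv H *v w\<close>.\<close>

lemma fenchel_young_quadratic:
  fixes H :: "real^'n^'n"
  assumes H: "pos_def H"
  shows "w \<bullet> u - 1/2 * mat_norm_sq H u \<le> 1/2 * mat_norm_sq (matrix_inv H) w"
proof -
  define v where "v = matrix_inv H *v w"
  have Hv: "H *v v = w"
    unfolding v_def using H by (rule pos_def_matrix_inv)
  have sym: "v \<bullet> (H *v u) = u \<bullet> w"
    using H symmetric_matrix_inner[of H v u] Hv by (simp add: pos_def_def)
  have "0 \<le> (u - v) \<bullet> (H *v (u - v))"
    using H unfolding pos_def_def by (cases "u - v = 0") (auto intro: less_imp_le)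
  also have "\<dots> = mat_norm_sq H u - 2 * (w \<bullet> u) + w \<bullet> v"
    using Hv sym
    by (simp add: mat_norm_sq_def matrix_vector_mult_diff_distrib inner_diff_left inner_diff_right
        inner_commute)
  finally show ?thesis
    unfolding v_def mat_norm_sq_def by simp
qed

section \<open>Minimising a strongly convex function plus a closed convex one\<close>

text \<open>A point strictly below the graph can be separated from the closed convex epigraph. The
  separating hyperplane is not vertical because the graph point above it lies on the other side,
  so the hyperplane is the graph of an affine function.\<close>

lemma closed_convex_affine_minorant:
  fixes h :: "'a::euclidean_space \<Rightarrow> ereal"
  assumes "proper_fun h" "closed_fun h" "convex_fun h"
  obtains \<alpha> \<beta> where "\<And>x r. (x, r) \<in> ext_epigraph h \<Longrightarrow> \<alpha> + \<beta> \<bullet> x \<le> r"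
proof -
  from assms(1) obtain x0 r0 where r0: "h x0 = ereal r0"
    unfolding proper_fun_def by (metis ereal_cases)
  have out: "(x0, r0 - 1) \<notin> ext_epigraph h" and in_epi: "(x0, r0) \<in> ext_epigraph h"
    using r0 by (auto simp: ext_epigraph_def)
  from assms(2,3) out separating_hyperplane_closed_point[of "ext_epigraph h" "(x0, r0 - 1)"]
  obtain a b where ab: "a \<bullet> (x0, r0 - 1) < b" "\<And>z. z \<in> ext_epigraph h \<Longrightarrow> b < a \<bullet> z"
    unfolding closed_fun_def convex_fun_def by blast
  obtain u s where a: "a = (u, s)"
    by (cases a)
  have s: "s > 0"
    using ab(1) ab(2)[OF in_epi] by (simp add: a algebra_simps)
  have "b / s + (- (u /\<^sub>R s)) \<bullet> x \<le> r" if "(x, r) \<in> ext_epigraph h" for x r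
    using ab(2)[OF that] s by (simp add: a field_simps)
  then show ?thesis
    using that by blast
qed

text \<open>Working on the epigraph replaces the extended-real-valued problem by the minimisation of the
  continuous real function \<open>(x, r) \<mapsto> f x - y \<bullet> x + r\<close> over a closed set. Its sublevel sets
  are bounded: \<open>f\<close> grows quadratically, whereas \<open>r\<close> is bounded below by an affine function
  of \<open>x\<close>. Hence the minimum is attained.\<close>

lemma tilted_minimizer_exists:
  fixes f :: "real^'n \<Rightarrow> real" and h :: "real^'n \<Rightarrow> ereal"
  assumes H: "pos_def H" and diff: "\<forall>x. f differentiable (at x)"
    and strong: "strongly_convex_with H f"
    and h: "proper_fun h" "closed_fun h" "convex_fun h"
  obtains x r where "(x, r) \<in> ext_epigraph h"
    "\<And>x' r'. (x', r') \<in> ext_epigraph h \<Longrightarrow> f x - y \<bullet> x + r \<le> f x' - y \<bullet> x' + r'"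
proof -
  define \<psi> where "\<psi> z = f (fst z) - y \<bullet> fst z + snd z" for z
  have "continuous_on UNIV f"
    using diff by (auto intro: differentiable_imp_continuous_on simp: differentiable_on_def)
  then have cont: "continuous_on UNIV \<psi>"
    unfolding \<psi>_def by (auto intro!: continuous_intros intro: continuous_on_compose2)
  from h(1) obtain x0 r0 where "h x0 = ereal r0"
    unfolding proper_fun_def by (metis ereal_cases)
  then have z0: "(x0, r0) \<in> ext_epigraph h"
    by (simp add: ext_epigraph_def)
  define M where "M = \<psi> (x0, r0)"
  define S where "S = ext_epigraph h \<inter> {z. \<psi> z \<le> M}"
  have "closed S"
    unfolding S_def using h(2) cont
    by (intro closed_Int closed_Collect_le) (auto simp: closed_fun_def)

  obtain \<mu> where \<mu>: "\<mu> > 0" "\<And>x. \<mu> * (norm x)\<^sup>2 \<le> mat_norm_sq H x"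
    using pos_def_coercive[OF H] by blast
  obtain \<alpha> \<beta> where minorant: "\<And>x r. (x, r) \<in> ext_epigraph h \<Longrightarrow> \<alpha> + \<beta> \<bullet> x \<le> r"
    using closed_convex_affine_minorant[OF h] by blast
  define g where "g = gradient f 0"
  have f_quad: "f 0 + g \<bullet> x + \<mu> / 2 * (norm x)\<^sup>2 \<le> f x" for x
  proof -
    have "f 0 + g \<bullet> (x - 0) + 1/2 * mat_norm_sq H (x - 0) \<le> f x"
      using strong unfolding strongly_convex_with_def g_def by blast
    then show ?thesis
      using \<mu>(2)[of x] by simp
  qed
  \<comment> \<open>On the sublevel set the lower bounds for \<open>f\<close> and \<open>r\<close> give a quadratic inequality for
    \<open>norm x\<close>. Since \<open>R\<close> is at least 1, only points outside the unit ball matter; there the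
    constant term is absorbed into the linear one and the inequality divided by \<open>norm x\<close>.\<close>
  define w where "w = g - y + \<beta>"
  define R where "R = 1 + 2 * (\<bar>M - f 0 - \<alpha>\<bar> + norm w) / \<mu>"
  have "R \<ge> 1"
    unfolding R_def using \<mu>(1) by simp
  have x_bound: "norm x \<le> R" if "(x, r) \<in> S" for x r
  proof (cases "norm x \<le> 1")
    case False
    have "f 0 + \<alpha> + w \<bullet> x + \<mu> / 2 * (norm x)\<^sup>2 \<le> M"
      using that minorant[of x r] f_quad[of x]
      by (simp add: S_def \<psi>_def w_def algebra_simps)
    moreover have "- (w \<bullet> x) \<le> norm w * norm x"
      using norm_cauchy_schwarz[of "-w" x] by simp
    moreover have "\<bar>M - f 0 - \<alpha>\<bar> * 1 \<le> \<bar>M - f 0 - \<alpha>\<bar> * norm x"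
      using False by (intro mult_left_mono) auto
    ultimately have "\<mu> / 2 * (norm x)\<^sup>2 \<le> (\<bar>M - f 0 - \<alpha>\<bar> + norm w) * norm x"
      by (simp add: algebra_simps)
    then have "(\<mu> / 2 * norm x) * norm x \<le> (\<bar>M - f 0 - \<alpha>\<bar> + norm w) * norm x"
      by (simp add: power2_eq_square mult_ac)
    then have "\<mu> / 2 * norm x \<le> \<bar>M - f 0 - \<alpha>\<bar> + norm w"
      by (rule mult_right_le_imp_le) (use False in auto)
    then have "norm x \<le> 2 * (\<bar>M - f 0 - \<alpha>\<bar> + norm w) / \<mu>"
      using \<mu>(1) by (simp add: field_simps)
    then show ?thesis
      by (simp add: R_def)
  qed (use \<open>R \<ge> 1\<close> in simp)
  have inner_bound: "\<bar>v \<bullet> x\<bar> \<le> norm v * R" if "(x, r) \<in> S" for v x r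
    using Cauchy_Schwarz_ineq2[of v x] mult_left_mono[OF x_bound[OF that] norm_ge_zero[of v]]
    by linarith
  have "S \<subseteq> cball 0 R \<times> {\<alpha> - norm \<beta> * R .. M - f 0 + norm g * R + norm y * R}"
  proof clarify
    fix x r assume xr: "(x, r) \<in> S"
    have "0 \<le> \<mu> / 2 * (norm x)\<^sup>2"
      using \<mu>(1) by simp
    then have "f 0 + g \<bullet> x \<le> f x"
      using f_quad[of x] by linarith
    moreover have "\<alpha> + \<beta> \<bullet> x \<le> r" "f x - y \<bullet> x + r \<le> M"
      using xr minorant by (auto simp: S_def \<psi>_def)
    ultimately show "x \<in> cball 0 R \<and>
        r \<in> {\<alpha> - norm \<beta> * R .. M - f 0 + norm g * R + norm y * R}"
      using x_bound[OF xr] inner_bound[OF xr, of \<beta>] inner_bound[OF xr, of g]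
        inner_bound[OF xr, of y]
      by (auto simp: abs_le_iff)
  qed
  then have "bounded S"
    by (rule bounded_subset[rotated]) (intro bounded_Times bounded_cball bounded_closed_interval)
  with \<open>closed S\<close> have "compact S"
    by (simp add: compact_eq_bounded_closed)
  moreover have "(x0, r0) \<in> S"
    using z0 by (simp add: S_def M_def)
  ultimately obtain z where z: "z \<in> S" "\<And>z'. z' \<in> S \<Longrightarrow> \<psi> z \<le> \<psi> z'"
    using continuous_attains_inf[of S \<psi>] continuous_on_subset[OF cont subset_UNIV] by blast
  have "\<psi> z \<le> \<psi> z'" if "z' \<in> ext_epigraph h" for z'
    using z that by (cases "\<psi> z' \<le> M") (auto simp: S_def)
  then show ?thesis
    using z(1) that[of "fst z" "snd z"] by (auto simp: S_def \<psi>_def)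
qed

text \<open>At a minimiser the one-sided directional derivative towards any other point of the epigraph
  is nonnegative, because the segment stays in the epigraph. Strong convexity of \<open>f\<close> at the
  minimiser turns this first-order condition into quadratic growth.\<close>

lemma tilted_minimizer_quadratic_growth:
  fixes f :: "real^'n \<Rightarrow> real" and h :: "real^'n \<Rightarrow> ereal"
  assumes diff: "f differentiable (at x)" and strong: "strongly_convex_with H f"
    and h: "convex_fun h"
    and x: "(x, r) \<in> ext_epigraph h"
    and minimal: "\<And>x' r'. (x', r') \<in> ext_epigraph h \<Longrightarrow> f x - y \<bullet> x + r \<le> f x' - y \<bullet> x' + r'"
    and z: "(z, s) \<in> ext_epigraph h"
  shows "f x - y \<bullet> x + r + 1/2 * mat_norm_sq H (z - x) \<le> f z - y \<bullet> z + s"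
proof -
  define v where "v = z - x"
  define \<phi> where "\<phi> t = f (x + t *\<^sub>R v) - y \<bullet> (x + t *\<^sub>R v) + (r + t * (s - r))" for t
  have "(f has_derivative (\<lambda>k. k \<bullet> gradient f x)) (at (x + 0 *\<^sub>R v))"
    using GDERIV_gradient[OF diff] by (simp add: gderiv_def)
  then have f_comp: "((\<lambda>t. f (x + t *\<^sub>R v)) has_derivative (\<lambda>t. (t *\<^sub>R v) \<bullet> gradient f x)) (at 0)"
    by (rule has_derivative_compose[rotated]) (auto intro!: derivative_eq_intros)
  have "(\<phi> has_derivative (\<lambda>t. (t *\<^sub>R v) \<bullet> gradient f x - y \<bullet> (t *\<^sub>R v) + t * (s - r))) (at 0)"
    unfolding \<phi>_def by (rule derivative_eq_intros f_comp refl | simp)+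
  then have deriv: "(\<phi> has_real_derivative (gradient f x \<bullet> v - y \<bullet> v + (s - r))) (at 0)"
    unfolding has_field_derivative_def
    by (rule has_derivative_eq_rhs) (auto simp: fun_eq_iff algebra_simps inner_commute)
  have on_segment: "\<phi> 0 \<le> \<phi> t" if "0 \<le> t" "t \<le> 1" for t
  proof -
    have "(1 - t) *\<^sub>R (x, r) + t *\<^sub>R (z, s) \<in> ext_epigraph h"
      using h x z that unfolding convex_fun_def by (intro convexD) auto
    also have "(1 - t) *\<^sub>R (x, r) + t *\<^sub>R (z, s) = (x + t *\<^sub>R v, r + t * (s - r))"
      by (simp add: v_def algebra_simps)
    finally show ?thesis
      using minimal by (fastforce simp: \<phi>_def)
  qed
  have "0 \<le> gradient f x \<bullet> v - y \<bullet> v + (s - r)"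
  proof (rule ccontr)
    assume "\<not> ?thesis"
    then obtain \<delta> where \<delta>: "\<delta> > 0" "\<And>t. 0 < t \<Longrightarrow> t < \<delta> \<Longrightarrow> \<phi> (0 + t) < \<phi> 0"
      using DERIV_neg_dec_right[OF deriv] by auto
    define t where "t = min (\<delta> / 2) 1"
    have "0 < t" "t < \<delta>" "t \<le> 1"
      using \<delta>(1) by (auto simp: t_def min_def)
    with \<delta>(2)[of t] on_segment[of t] show False
      by simp
  qed
  moreover have "f x + gradient f x \<bullet> v + 1/2 * mat_norm_sq H v \<le> f z"
    using strong unfolding strongly_convex_with_def v_def by blast
  ultimately show ?thesis
    by (simp add: v_def inner_diff_right)
qed

section \<open>Smoothness of the conjugate\<close>

lemma conjugate_maximizer:
  fixes f :: "real^'n \<Rightarrow> real" and h :: "real^'n \<Rightarrow> ereal"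
  assumes H: "pos_def H" and diff: "\<forall>x. f differentiable (at x)"
    and strong: "strongly_convex_with H f"
    and h: "proper_fun h" "closed_fun h" "convex_fun h"
    and F: "F = (\<lambda>x. ereal (f x) + h x)"
  obtains x s where "F x = ereal s" "conjugate F y = ereal (y \<bullet> x - s)"
    "\<And>z. ereal (y \<bullet> z) - F z \<le> ereal (y \<bullet> x - s - 1/2 * mat_norm_sq H (z - x))"
proof -
  obtain x r where x: "(x, r) \<in> ext_epigraph h"
    and minimal: "\<And>x' r'. (x', r') \<in> ext_epigraph h \<Longrightarrow> f x - y \<bullet> x + r \<le> f x' - y \<bullet> x' + r'"
    using tilted_minimizer_exists[OF H diff strong h] by blast
  \<comment> \<open>The minimiser over the epigraph lies on the graph: moving down to the graph lowers the
    objective.\<close>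
  have hx: "h x = ereal r"
  proof (cases "h x")
    case (real r')
    then show ?thesis
      using minimal[of x r'] x by (auto simp: ext_epigraph_def)
  qed (use x h(1) in \<open>auto simp: ext_epigraph_def proper_fun_def\<close>)
  define s where "s = f x + r"
  have growth: "ereal (y \<bullet> z) - F z \<le> ereal (y \<bullet> x - s - 1/2 * mat_norm_sq H (z - x))" for z
  proof (cases "h z")
    case (real q)
    then have "(z, q) \<in> ext_epigraph h"
      by (simp add: ext_epigraph_def)
    from tilted_minimizer_quadratic_growth[OF _ strong h(3) x minimal this] diff
    show ?thesis
      by (simp add: F real s_def)
  qed (use h(1) in \<open>auto simp: F proper_fun_def\<close>)
  have Fx: "F x = ereal s"
    by (simp add: F hx s_def)
  have "conjugate F y \<le> ereal (y \<bullet> x - s)"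
    unfolding conjugate_def
  proof (rule SUP_least)
    fix z
    have "0 \<le> mat_norm_sq H (z - x)"
      using H unfolding pos_def_def mat_norm_sq_def
      by (cases "z - x = 0") (auto intro: less_imp_le)
    then show "ereal (y \<bullet> z) - F z \<le> ereal (y \<bullet> x - s)"
      by (intro order_trans[OF growth]) simp
  qed
  moreover have "ereal (y \<bullet> x - s) \<le> conjugate F y"
    unfolding conjugate_def using Fx by (intro SUP_upper2[of x]) auto
  ultimately show ?thesis
    using that Fx growth by (metis order_antisym)
qed

text \<open>The lower bound is the subgradient inequality at the maximiser \<open>x\<close>. For the upper bound,
  the quadratic growth of \<open>F\<close> around \<open>x\<close> bounds the conjugate at \<open>y'\<close> by the conjugate of a
  quadratic form, which is the form of the inverse matrix.\<close>

lemma conjugate_quadratic_bounds: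
  fixes f :: "real^'n \<Rightarrow> real" and h :: "real^'n \<Rightarrow> ereal"
  assumes H: "pos_def H" and diff: "\<forall>x. f differentiable (at x)"
    and strong: "strongly_convex_with H f"
    and h: "proper_fun h" "closed_fun h" "convex_fun h"
    and F: "F = (\<lambda>x. ereal (f x) + h x)"
  obtains \<Phi> where "\<And>y. conjugate F y = ereal (\<Phi> y)"
    "\<And>y. \<exists>x. \<forall>y'. \<Phi> y + (y' - y) \<bullet> x \<le> \<Phi> y' \<and>
       \<Phi> y' \<le> \<Phi> y + (y' - y) \<bullet> x + 1/2 * mat_norm_sq (matrix_inv H) (y' - y)"
proof -
  define \<Phi> where "\<Phi> y = real_of_ereal (conjugate F y)" for y
  have \<Phi>: "conjugate F y = ereal (\<Phi> y)" for y
    by (rule conjugate_maximizer[OF assms, of y]) (simp add: \<Phi>_def)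
  have "\<exists>x. \<forall>y'. \<Phi> y + (y' - y) \<bullet> x \<le> \<Phi> y' \<and>
      \<Phi> y' \<le> \<Phi> y + (y' - y) \<bullet> x + 1/2 * mat_norm_sq (matrix_inv H) (y' - y)" for y
  proof -
    obtain x s where Fx: "F x = ereal s" and at_y: "conjugate F y = ereal (y \<bullet> x - s)"
      and growth: "\<And>z. ereal (y \<bullet> z) - F z
        \<le> ereal (y \<bullet> x - s - 1/2 * mat_norm_sq H (z - x))"
      using conjugate_maximizer[OF assms, of y] by blast
    have \<Phi>_y: "\<Phi> y = y \<bullet> x - s"
      using at_y by (simp add: \<Phi>_def)
    have "\<Phi> y + (y' - y) \<bullet> x \<le> \<Phi> y'" for y'
    proof -
      have "ereal (y' \<bullet> x) - F x \<le> conjugate F y'"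
        unfolding conjugate_def by (rule SUP_upper) simp
      then show ?thesis
        by (simp add: Fx \<Phi> \<Phi>_y inner_diff_left)
    qed
    moreover have "\<Phi> y' \<le> \<Phi> y + (y' - y) \<bullet> x + 1/2 * mat_norm_sq (matrix_inv H) (y' - y)" for y'
    proof -
      have "conjugate F y'
          \<le> ereal (\<Phi> y + (y' - y) \<bullet> x + 1/2 * mat_norm_sq (matrix_inv H) (y' - y))"
        unfolding conjugate_def
      proof (rule SUP_least)
        fix z
        show "ereal (y' \<bullet> z) - F z
            \<le> ereal (\<Phi> y + (y' - y) \<bullet> x + 1/2 * mat_norm_sq (matrix_inv H) (y' - y))"
        proof (cases "F z")
          case (real q)
          then have "y \<bullet> z - q \<le> \<Phi> y - 1/2 * mat_norm_sq H (z - x)"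
            using growth[of z] by (simp add: \<Phi>_y)
          moreover have "(y' - y) \<bullet> (z - x) - 1/2 * mat_norm_sq H (z - x)
              \<le> 1/2 * mat_norm_sq (matrix_inv H) (y' - y)"
            using H by (rule fenchel_young_quadratic)
          ultimately show ?thesis
            by (simp add: real inner_diff_left inner_diff_right)
        qed (use growth[of z] in auto)
      qed
      then show ?thesis
        by (simp add: \<Phi>)
    qed
    ultimately show ?thesis
      by blast
  qed
  with \<Phi> show ?thesis
    using that by blast
qed

section \<open>Functions with supergradients and a quadratic lower bound\<close>

lemma supergradients_imp_concave:
  fixes D :: "'a::real_inner \<Rightarrow> real"
  assumes "\<And>x. \<exists>g. \<forall>x'. D x' \<le> D x + g \<bullet> (x' - x)"
  shows "concave_on UNIV D"
  unfolding concave_on_iff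
proof (intro conjI ballI allI impI)
  fix x y :: 'a and u v :: real
  assume uv: "0 \<le> u" "0 \<le> v" "u + v = 1"
  define z where "z = u *\<^sub>R x + v *\<^sub>R y"
  obtain g where g: "\<And>x'. D x' \<le> D z + g \<bullet> (x' - z)"
    using assms by blast
  have "u * D x + v * D y \<le> u * (D z + g \<bullet> (x - z)) + v * (D z + g \<bullet> (y - z))"
    using uv by (intro add_mono mult_left_mono g)
  also have "\<dots> = (u + v) * D z + g \<bullet> (z - (u + v) *\<^sub>R z)"
    by (simp add: z_def algebra_simps)
  finally show "u * D x + v * D y \<le> D (u *\<^sub>R x + v *\<^sub>R y)"
    using uv by (simp add: z_def)
qed simp

text \<open>The deviation from the affine model is trapped between zero and a multiple of the squared
  distance, hence is of smaller order than the distance.\<close>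

lemma quadratic_bounds_imp_GDERIV:
  fixes D :: "real^'k \<Rightarrow> real"
  assumes upper: "\<And>x'. D x' \<le> D x + g \<bullet> (x' - x)"
    and lower: "\<And>x'. D x + g \<bullet> (x' - x) - 1/2 * mat_norm_sq M (x' - x) \<le> D x'"
  shows "GDERIV D x :> g"
proof -
  obtain K where K: "\<And>u. mat_norm_sq M u \<le> K * (norm u)\<^sup>2"
    using mat_norm_sq_le_norm_sq by blast
  have "((\<lambda>k. norm (D (x + k) - D x - k \<bullet> g) / norm k) \<longlongrightarrow> 0) (at 0)"
  proof (rule tendsto_sandwich[of "\<lambda>_. 0"])
    show "((\<lambda>k::real^'k. K / 2 * norm k) \<longlongrightarrow> 0) (at 0)"
      by (auto intro!: tendsto_eq_intros)
    have "norm (D (x + k) - D x - k \<bullet> g) / norm k \<le> K / 2 * norm k" if "k \<noteq> 0" for k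
    proof -
      have "norm (D (x + k) - D x - k \<bullet> g) \<le> 1/2 * mat_norm_sq M k"
        using upper[of "x + k"] lower[of "x + k"] by (simp add: inner_commute)
      also have "\<dots> \<le> 1/2 * (K * (norm k)\<^sup>2)"
        using K by simp
      finally show ?thesis
        using that by (simp add: power2_eq_square divide_simps)
    qed
    then show "\<forall>\<^sub>F k in at 0. norm (D (x + k) - D x - k \<bullet> g) / norm k \<le> K / 2 * norm k"
      by (auto simp: eventually_at_filter)
  qed auto
  then show ?thesis
    unfolding gderiv_def has_derivative_at by (simp add: bounded_linear_inner_left)
qed

section \<open>The dual function\<close>

theorem theorem12:
  fixes f :: "real^'n \<Rightarrow> real" and h :: "real^'n \<Rightarrow> ereal" and H :: "real^'n^'n"
    and A :: "real^'n^'m" and B :: "real^'n^'p" and b :: "real^'m"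
    and C :: "real^'n^('m + 'p)" and c :: "real^('m + 'p)"
    and F :: "real^'n \<Rightarrow> ereal" and d :: "real^('m + 'p) \<Rightarrow> real"
  assumes H: "pos_def H"
    and f_diff: "\<forall>x. f differentiable (at x)"
    and f_strong: "strongly_convex_with H f"
    and h_proper: "proper_fun h"
    and h_closed: "closed_fun h"
    and h_convex: "convex_fun h"
    and A_rank: "rank A = CARD('m)"
    and C_eq: "C = stack_rows A B"
    and c_eq: "c = stack_vec b 0"
    and F_eq: "F = (\<lambda>x. ereal (f x) + h x)"
    and d_eq: "d = (\<lambda>\<nu>. real_of_ereal (dual_fun F C c \<nu>))"
  shows "(\<forall>\<nu>. \<bar>dual_fun F C c \<nu>\<bar> \<noteq> \<infinity>) \<and>
    concave_on UNIV d \<and>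
    (\<forall>\<nu>. d differentiable (at \<nu>)) \<and>
    (\<forall>\<nu>1 \<nu>2 L. pos_semidef L \<and> loewner_ge L (C ** matrix_inv H ** transpose C) \<longrightarrow>
       d \<nu>1 \<ge> d \<nu>2 + gradient d \<nu>2 \<bullet> (\<nu>1 - \<nu>2) - 1/2 * mat_norm_sq L (\<nu>1 - \<nu>2))"
proof -
  obtain \<Phi> where \<Phi>: "\<And>y. conjugate F y = ereal (\<Phi> y)"
    and bounds: "\<And>y. \<exists>x. \<forall>y'. \<Phi> y + (y' - y) \<bullet> x \<le> \<Phi> y' \<and>
       \<Phi> y' \<le> \<Phi> y + (y' - y) \<bullet> x + 1/2 * mat_norm_sq (matrix_inv H) (y' - y)"
    using conjugate_quadratic_bounds[OF H f_diff f_strong h_proper h_closed h_convex F_eq] by blast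
  have dual: "dual_fun F C c \<nu> = ereal (- \<Phi> (- (transpose C *v \<nu>)) - c \<bullet> \<nu>)" for \<nu>
    by (simp add: dual_fun_def \<Phi>)
  then have d: "d \<nu> = - \<Phi> (- (transpose C *v \<nu>)) - c \<bullet> \<nu>" for \<nu>
    by (simp add: d_eq)
  define M where "M = C ** matrix_inv H ** transpose C"
  have d_bounds: "\<exists>g. \<forall>\<nu>'. d \<nu>' \<le> d \<nu> + g \<bullet> (\<nu>' - \<nu>) \<and>
      d \<nu> + g \<bullet> (\<nu>' - \<nu>) - 1/2 * mat_norm_sq M (\<nu>' - \<nu>) \<le> d \<nu>'" for \<nu>
  proof -
    obtain x where x: "\<And>y'. \<Phi> (- (transpose C *v \<nu>)) + (y' - - (transpose C *v \<nu>)) \<bullet> x \<le> \<Phi> y' \<and>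
       \<Phi> y' \<le> \<Phi> (- (transpose C *v \<nu>)) + (y' - - (transpose C *v \<nu>)) \<bullet> x
         + 1/2 * mat_norm_sq (matrix_inv H) (y' - - (transpose C *v \<nu>))"
      using bounds by blast
    have "d \<nu>' \<le> d \<nu> + (C *v x - c) \<bullet> (\<nu>' - \<nu>) \<and>
      d \<nu> + (C *v x - c) \<bullet> (\<nu>' - \<nu>) - 1/2 * mat_norm_sq M (\<nu>' - \<nu>) \<le> d \<nu>'" for \<nu>'
    proof -
      define \<delta> where "\<delta> = \<nu>' - \<nu>"
      have step: "- (transpose C *v \<nu>') - - (transpose C *v \<nu>) = - (transpose C *v \<delta>)"
        by (simp add: \<delta>_def matrix_vector_mult_diff_distrib)
      have adj: "(transpose C *v \<delta>) \<bullet> u = \<delta> \<bullet> (C *v u)" for u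
        by (simp add: transpose_matrix_vector dot_lmul_matrix)
      have "(- (transpose C *v \<delta>)) \<bullet> x = - ((C *v x) \<bullet> \<delta>)"
        by (simp only: inner_minus_left adj inner_commute[of "C *v x"])
      moreover have "mat_norm_sq (matrix_inv H) (- (transpose C *v \<delta>)) = mat_norm_sq M \<delta>"
        by (simp add: mat_norm_sq_def M_def linear_neg[OF matrix_vector_mul_linear] adj
            matrix_vector_mul_assoc[symmetric] del: transpose_matrix_vector)
      moreover have "(C *v x - c) \<bullet> \<delta> = (C *v x) \<bullet> \<delta> - c \<bullet> \<nu>' + c \<bullet> \<nu>"
        by (simp add: \<delta>_def algebra_simps)
      ultimately show ?thesis
        using x[of "- (transpose C *v \<nu>')"] unfolding step d \<delta>_def[symmetric] by linarith
    qed
    then show ?thesis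
      by blast
  qed
  have smooth: "d differentiable (at \<nu>)
      \<and> d \<nu> + gradient d \<nu> \<bullet> (\<nu>' - \<nu>) - 1/2 * mat_norm_sq M (\<nu>' - \<nu>) \<le> d \<nu>'" for \<nu> \<nu>'
  proof -
    obtain g where g: "\<And>\<nu>'. d \<nu>' \<le> d \<nu> + g \<bullet> (\<nu>' - \<nu>)"
      "\<And>\<nu>'. d \<nu> + g \<bullet> (\<nu>' - \<nu>) - 1/2 * mat_norm_sq M (\<nu>' - \<nu>) \<le> d \<nu>'"
      using d_bounds[of \<nu>] by blast
    then have "GDERIV d \<nu> :> g"
      by (rule quadratic_bounds_imp_GDERIV)
    then show ?thesis
      using g(2)[of \<nu>'] gradient_eqI by (auto simp: gderiv_def differentiable_def)
  qed
  show ?thesis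
  proof (intro conjI allI impI)
    show "\<bar>dual_fun F C c \<nu>\<bar> \<noteq> \<infinity>" for \<nu>
      by (simp add: dual)
    show "concave_on UNIV d"
      using d_bounds by (intro supergradients_imp_concave) blast
    show "d differentiable (at \<nu>)" for \<nu>
      using smooth by blast
    show "d \<nu>1 \<ge> d \<nu>2 + gradient d \<nu>2 \<bullet> (\<nu>1 - \<nu>2) - 1/2 * mat_norm_sq L (\<nu>1 - \<nu>2)"
      if "pos_semidef L \<and> loewner_ge L (C ** matrix_inv H ** transpose C)" for \<nu>1 \<nu>2 L
    proof -
      have "mat_norm_sq M (\<nu>1 - \<nu>2) \<le> mat_norm_sq L (\<nu>1 - \<nu>2)"
        using that unfolding loewner_ge_def pos_semidef_def M_def[symmetric]
        by (simp add: mat_norm_sq_def matrix_vector_mult_diff_rdistrib inner_diff_right)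
      then show ?thesis
        using smooth[of \<nu>2 \<nu>1] by linarith
    qed
  qed
qed

end
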